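(* There is a polynomial-time algorithm that, given a weighted house allocation instance $\langle N,H,V\rangle$, finds an envy-free allocation of maximum utilitarian welfare, should one exist; that is, it returns an envy-free allocation $A$ with $\mathrm{USW}(A)=\max_{B}\mathrm{USW}(B)$, where $B$ ranges over all allocations, if such an $A$ exists, and otherwise reports that none exists.
   Context: A house allocation instance $\langle N,H,V\rangle$ consists of a finite set $N$ of $n$ agents, a finite set $H$ of $m$ houses, and for each agent $i\in N$ a valuation $v_i:H\to\mathbb{R}_{\ge 0}$, with the convention $v_i(\emptyset)=0$. A weighted instance allows arbitrary non-negative values. An allocation $A$ assigns to each agent $i$ either one house $A(i)\in H$ or nothing ($A(i)=\emptyset$), with each house assigned to at most one agent; an agent may be assigned a house it values at zero, and houses may remain unassigned. An allocation $A$ is envy-free if $v_i(A(i))\ge v_i(A(j))$ for all $i,j\in N$. The utilitarian welfare is $\mathrm{USW}(A)=\sum_{i\in N}v_i(A(i))$. *)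

theory Defs
  imports Complex_Main "HOL-Computational_Algebra.Polynomial"
begin

section \<open>House allocation\<close>

definition house_instance :: "'a set \<Rightarrow> 'h set \<Rightarrow> ('a \<Rightarrow> 'h \<Rightarrow> real) \<Rightarrow> bool" where
  "house_instance N H v \<longleftrightarrow> finite N \<and> finite H \<and> (\<forall>i\<in>N. \<forall>h\<in>H. 0 \<le> v i h)"

text \<open>The value \<open>None\<close> stands for receiving nothing.\<close>

definition allocation :: "'a set \<Rightarrow> 'h set \<Rightarrow> ('a \<rightharpoonup> 'h) \<Rightarrow> bool" where
  "allocation N H A \<longleftrightarrow> dom A \<subseteq> N \<and> ran A \<subseteq> H \<and> inj_on A (dom A)"

primrec bundle_value :: "('h \<Rightarrow> real) \<Rightarrow> 'h option \<Rightarrow> real" where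
  "bundle_value u None = 0"
| "bundle_value u (Some h) = u h"

definition envy_free :: "'a set \<Rightarrow> ('a \<Rightarrow> 'h \<Rightarrow> real) \<Rightarrow> ('a \<rightharpoonup> 'h) \<Rightarrow> bool" where
  "envy_free N v A \<longleftrightarrow>
     (\<forall>i\<in>N. \<forall>j\<in>N. bundle_value (v i) (A i) \<ge> bundle_value (v i) (A j))"

definition USW :: "'a set \<Rightarrow> ('a \<Rightarrow> 'h \<Rightarrow> real) \<Rightarrow> ('a \<rightharpoonup> 'h) \<Rightarrow> real" where
  "USW N v A = (\<Sum>i\<in>N. bundle_value (v i) (A i))"

text \<open>The maximum ranges over all allocations, not only the envy-free ones.\<close>

definition envy_free_max_USW ::
    "'a set \<Rightarrow> 'h set \<Rightarrow> ('a \<Rightarrow> 'h \<Rightarrow> real) \<Rightarrow> ('a \<rightharpoonup> 'h) \<Rightarrow> bool" where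
  "envy_free_max_USW N H v A \<longleftrightarrow>
     allocation N H A \<and> envy_free N v A \<and>
     USW N v A = Max {USW N v B | B. allocation N H B}"

lemma finite_allocations:
  assumes "finite N" "finite H"
  shows "finite {A. allocation N H A}"
proof -
  have "{A. allocation N H A} \<subseteq> (\<Union>D\<in>Pow N. {A. dom A = D \<and> ran A \<subseteq> H})"
    by (auto simp: allocation_def)
  moreover have "finite (\<Union>D\<in>Pow N. {A. dom A = D \<and> ran A \<subseteq> H})"
    using assms by (auto intro!: finite_set_of_finite_maps intro: finite_subset)
  ultimately show ?thesis
    by (rule finite_subset)
qed

section \<open>Machine model\<close>

text \<open>
  Programs run on a random access machine over the reals: a finite number of unbounded arrays
  of natural numbers and of reals, indirect addressing by natural numbers, and unit cost for each
  operation.  Valuations are arbitrary reals, so they are atomic values of the machine.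

  The operations are restricted so that unit cost is an honest measure of time.  There is no
  multiplication, hence a number computed in \<open>t\<close> steps is an integer combination of the input
  with coefficients of \<open>O(t)\<close> bits, and for rational inputs the number of steps agrees with
  bit complexity up to a polynomial.  There is no real constant other than zero, in which
  information could be hidden, and no conversion between reals and natural numbers.
\<close>

type_synonym vname = string

record state =
  nmem :: "vname \<Rightarrow> nat \<Rightarrow> nat"
  rmem :: "vname \<Rightarrow> nat \<Rightarrow> real"

datatype nexp =
    NConst nat
  | NRead vname nexp
  | NAdd nexp nexp
  | NSub nexp nexp

datatype rexp =
    RZero
  | RRead vname nexp
  | RAdd rexp rexp
  | RSub rexp rexp

datatype bexp =
    NLess nexp nexp
  | RLess rexp rexp
  | BNot bexp
  | BAnd bexp bexp

datatype com =
    SKIP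
  | NWrite vname nexp nexp
  | RWrite vname nexp rexp
  | Seq com com
  | Cond bexp com com
  | While bexp com

primrec nval :: "nexp \<Rightarrow> state \<Rightarrow> nat" where
  "nval (NConst k) s = k"
| "nval (NRead x a) s = nmem s x (nval a s)"
| "nval (NAdd a b) s = nval a s + nval b s"
| "nval (NSub a b) s = nval a s - nval b s"

primrec rval :: "rexp \<Rightarrow> state \<Rightarrow> real" where
  "rval RZero s = 0"
| "rval (RRead x a) s = rmem s x (nval a s)"
| "rval (RAdd a b) s = rval a s + rval b s"
| "rval (RSub a b) s = rval a s - rval b s"

primrec bval :: "bexp \<Rightarrow> state \<Rightarrow> bool" where
  "bval (NLess a b) s \<longleftrightarrow> nval a s < nval b s"
| "bval (RLess a b) s \<longleftrightarrow> rval a s < rval b s"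
| "bval (BNot b) s \<longleftrightarrow> \<not> bval b s"
| "bval (BAnd b c) s \<longleftrightarrow> bval b s \<and> bval c s"

primrec ncost :: "nexp \<Rightarrow> nat" where
  "ncost (NConst k) = 1"
| "ncost (NRead x a) = 1 + ncost a"
| "ncost (NAdd a b) = 1 + ncost a + ncost b"
| "ncost (NSub a b) = 1 + ncost a + ncost b"

primrec rcost :: "rexp \<Rightarrow> nat" where
  "rcost RZero = 1"
| "rcost (RRead x a) = 1 + ncost a"
| "rcost (RAdd a b) = 1 + rcost a + rcost b"
| "rcost (RSub a b) = 1 + rcost a + rcost b"

primrec bcost :: "bexp \<Rightarrow> nat" where
  "bcost (NLess a b) = 1 + ncost a + ncost b"
| "bcost (RLess a b) = 1 + rcost a + rcost b"
| "bcost (BNot b) = 1 + bcost b"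
| "bcost (BAnd b c) = 1 + bcost b + bcost c"

definition nwrite :: "vname \<Rightarrow> nat \<Rightarrow> nat \<Rightarrow> state \<Rightarrow> state" where
  "nwrite x k a s = s\<lparr>nmem := (nmem s)(x := (nmem s x)(k := a))\<rparr>"

definition rwrite :: "vname \<Rightarrow> nat \<Rightarrow> real \<Rightarrow> state \<Rightarrow> state" where
  "rwrite x k a s = s\<lparr>rmem := (rmem s)(x := (rmem s x)(k := a))\<rparr>"

text \<open>\<open>exec c s t s'\<close>: started in \<open>s\<close>, program \<open>c\<close> terminates in \<open>s'\<close> after \<open>t\<close> steps.\<close>

inductive exec :: "com \<Rightarrow> state \<Rightarrow> nat \<Rightarrow> state \<Rightarrow> bool" where
  Skip: "exec SKIP s 1 s"
| NWrite: "exec (NWrite x a b) s (1 + ncost a + ncost b) (nwrite x (nval a s) (nval b s) s)"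
| RWrite: "exec (RWrite x a b) s (1 + ncost a + rcost b) (rwrite x (nval a s) (rval b s) s)"
| Seq: "\<lbrakk>exec c s t s'; exec d s' t' s''\<rbrakk> \<Longrightarrow> exec (Seq c d) s (1 + t + t') s''"
| CondTrue: "\<lbrakk>bval b s; exec c s t s'\<rbrakk> \<Longrightarrow> exec (Cond b c d) s (1 + bcost b + t) s'"
| CondFalse: "\<lbrakk>\<not> bval b s; exec d s t s'\<rbrakk> \<Longrightarrow> exec (Cond b c d) s (1 + bcost b + t) s'"
| WhileFalse: "\<not> bval b s \<Longrightarrow> exec (While b c) s (1 + bcost b) s"
| WhileTrue: "\<lbrakk>bval b s; exec c s t s'; exec (While b c) s' t' s''\<rbrakk>
    \<Longrightarrow> exec (While b c) s (1 + bcost b + t + t') s''"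

inductive_cases exec_elims:
  "exec SKIP s t s'"
  "exec (NWrite x a b) s t s'"
  "exec (RWrite x a b) s t s'"
  "exec (Seq c d) s t s'"
  "exec (Cond b c d) s t s'"
  "exec (While b c) s t s'"

lemma exec_deterministic:
  "exec c s t s' \<Longrightarrow> exec c s u s'' \<Longrightarrow> t = u \<and> s' = s''"
proof (induction arbitrary: u s'' rule: exec.induct)
  case (Skip s)
  then show ?case by - (erule exec_elims, simp)
next
  case (NWrite x a b s)
  then show ?case by - (erule exec_elims, simp)
next
  case (RWrite x a b s)
  then show ?case by - (erule exec_elims, simp)
next
  case (Seq c s t s' d t' r)
  from Seq.prems obtain t1 s1 t2
    where *: "u = 1 + t1 + t2" "exec c s t1 s1" "exec d s1 t2 s''"
    by - (erule exec_elims(4), simp)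
  show ?case
    using Seq.IH(1)[OF *(2)] Seq.IH(2)[of t2 s''] * by simp
next
  case (CondTrue b s c t s' d)
  from CondTrue.prems CondTrue.hyps(1) obtain t1
    where *: "u = 1 + bcost b + t1" "exec c s t1 s''"
    by - (erule exec_elims(5), simp_all)
  show ?case
    using CondTrue.IH[OF *(2)] * by simp
next
  case (CondFalse b s d t s' c)
  from CondFalse.prems CondFalse.hyps(1) obtain t1
    where *: "u = 1 + bcost b + t1" "exec d s t1 s''"
    by - (erule exec_elims(5), simp_all)
  show ?case
    using CondFalse.IH[OF *(2)] * by simp
next
  case (WhileFalse b s c)
  from WhileFalse.prems WhileFalse.hyps show ?case
    by - (erule exec_elims(6), simp_all)
next
  case (WhileTrue b s c t s' t' r)
  from WhileTrue.prems WhileTrue.hyps(1) obtain t1 s1 t2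
    where *: "u = 1 + bcost b + t1 + t2" "exec c s t1 s1" "exec (While b c) s1 t2 s''"
    by - (erule exec_elims(6), simp_all)
  show ?case
    using WhileTrue.IH(1)[OF *(2)] WhileTrue.IH(2)[of t2 s''] * by simp
qed

section \<open>Input and output\<close>

text \<open>
  Agents and houses are presented to the machine by their indices, below \<open>n\<close> and below \<open>m\<close>.
  Cell \<open>i * m + j\<close> of the real array \<open>v\<close> holds the value of house \<open>j\<close> for agent \<open>i\<close>;
  all cells not used for the input are zero.
\<close>

definition input :: "nat \<Rightarrow> nat \<Rightarrow> (nat \<Rightarrow> nat \<Rightarrow> real) \<Rightarrow> state" where
  "input n m v =
     \<lparr>nmem = (\<lambda>x k. if x = ''n'' \<and> k = 0 then n else if x = ''m'' \<and> k = 0 then m else 0),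
      rmem = (\<lambda>x k. if x = ''v'' \<and> k < n * m then v (k div m) (k mod m) else 0)\<rparr>"

text \<open>
  The program reports that there is no solution by \<open>found[0] = 0\<close>.  Otherwise \<open>alloc[i] = 0\<close>
  means that agent \<open>i\<close> receives nothing, and \<open>alloc[i] = h + 1\<close> that it receives house \<open>h\<close>.
\<close>

definition answer :: "nat \<Rightarrow> state \<Rightarrow> (nat \<rightharpoonup> nat) option" where
  "answer n s =
     (if nmem s ''found'' 0 = 0 then None
      else Some (\<lambda>i. if i < n
                     then (case nmem s ''alloc'' i of 0 \<Rightarrow> None | Suc h \<Rightarrow> Some h)
                     else None))"

end

theory Submission
  imports Defs
begin

text \<open>
  An envy-free allocation of maximum welfare gives every agent a value that is maximal over
  all houses: a better house that is assigned would cause envy, and a better one that is free could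
  be handed over to increase the welfare.  Conversely, such an allocation is clearly envy-free and
  optimal.  So the problem is bipartite matching between the agents with a positive value and
  their favourite houses.

  The matching is found by an auction.  Each house carries a label, initially \<open>0\<close>; an agent without
  a house takes a favourite house of least label, displaces its owner, and raises the label by one.
  If all favourites of an agent \<open>i\<close> without a house have label at least \<open>n\<close>, no matching exists: an owner
  of a house of label \<open>k + 1\<close> only has favourites of label at least \<open>k\<close>, so a matching would send \<open>i\<close> and the
  owners of the houses of label greater than \<open>k\<close> injectively to houses of label at least \<open>k\<close>.  Downward
  from \<open>k = n\<close> these sets of houses thus grow by one at each level, which leads to more than \<open>n\<close> agents.
\<close>

section \<open>Welfare-maximal envy-free allocations\<close>

lemma USW_le_bundle:
  assumes "\<And>i h. i \<in> N \<Longrightarrow> h \<in> H \<Longrightarrow> v i h \<le> bundle_value (v i) (A i)"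
    and "\<And>i. i \<in> N \<Longrightarrow> 0 \<le> bundle_value (v i) (A i)" and "allocation N H B"
  shows "USW N v B \<le> USW N v A"
  unfolding USW_def
proof (rule sum_mono)
  fix i assume i: "i \<in> N"
  show "bundle_value (v i) (B i) \<le> bundle_value (v i) (A i)"
  proof (cases "B i")
    case None
    then show ?thesis using assms(2)[OF i] by simp
  next
    case (Some h)
    then have "h \<in> H" using assms(3) by (auto simp: allocation_def ran_def)
    then show ?thesis using assms(1)[OF i] Some by simp
  qed
qed

text \<open>Turns envy-freeness and the maximum over all allocations into one condition on each
  agent separately. As \<open>bundle_value\<close> is 0 for no house, an agent can stay without a
  house exactly if it values none positively.\<close>

lemma envy_free_max_USW_iff:
  assumes inst: "house_instance N H v"
  shows "envy_free_max_USW N H v A \<longleftrightarrow>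
    allocation N H A \<and> (\<forall>i\<in>N. \<forall>h\<in>H. v i h \<le> bundle_value (v i) (A i))"
proof (cases "allocation N H A")
  case alloc: True
  let ?W = "{USW N v B | B. allocation N H B}"
  have fin: "finite N" "finite H" and nonneg: "\<And>i h. i \<in> N \<Longrightarrow> h \<in> H \<Longrightarrow> 0 \<le> v i h"
    using inst by (auto simp: house_instance_def)
  have W: "finite ?W"
    using finite_imageI[OF finite_allocations[OF fin], of "USW N v"]
    by (simp add: image_Collect)
  have ran: "h \<in> H" if "A i = Some h" for i h
    using alloc that by (auto simp: allocation_def ran_def)
  have "v i h \<le> bundle_value (v i) (A i)"
    if opt: "envy_free_max_USW N H v A" and i: "i \<in> N" and h: "h \<in> H" for i h
  proof (cases "h \<in> ran A")
    case True
    then obtain j where j: "A j = Some h" by (auto simp: ran_def)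
    then have "j \<in> N" using alloc by (auto simp: allocation_def)
    then have "bundle_value (v i) (A j) \<le> bundle_value (v i) (A i)"
      using opt i by (auto simp: envy_free_max_USW_def envy_free_def)
    then show ?thesis using j by simp
  next
    case False
    \<comment> \<open>The update also releases the former house of \<open>i\<close>, so
      \<open>?B\<close> is again an allocation, and only the summand of \<open>i\<close> in the
      welfare changes.\<close>
    let ?B = "A(i \<mapsto> h)"
    have "allocation N H ?B"
      using alloc i h False
      by (auto simp: allocation_def ran_def inj_on_def split: if_splits)
    then have "USW N v ?B \<in> ?W" by blast
    then have "USW N v ?B \<le> USW N v A"
      using opt W by (simp add: envy_free_max_USW_def)
    then show ?thesis
      using fin(1) i by (simp add: USW_def sum.remove[of N i])
  qed
  moreover have "envy_free_max_USW N H v A"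
    if best: "\<forall>i\<in>N. \<forall>h\<in>H. v i h \<le> bundle_value (v i) (A i)"
  proof -
    have pos: "0 \<le> bundle_value (v i) (A i)" if "i \<in> N" for i
      using nonneg[OF that] ran by (cases "A i") auto
    have "USW N v A = Max ?W"
      using W alloc best pos by (intro Max_eqI[symmetric]) (auto intro: USW_le_bundle)
    moreover have "envy_free N v A"
      unfolding envy_free_def
    proof (intro ballI)
      fix i j assume "i \<in> N" "j \<in> N"
      then show "bundle_value (v i) (A j) \<le> bundle_value (v i) (A i)"
        using best pos ran by (cases "A j") auto
    qed
    ultimately show ?thesis using alloc by (simp add: envy_free_max_USW_def)
  qed
  ultimately show ?thesis using alloc by blast
qed (simp add: envy_free_max_USW_def)

section \<open>Labels certifying that no matching exists\<close>

text \<open>The counting argument detached from the auction: \<open>M\<close> is the set of agents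
  to be matched, \<open>F\<close> gives their admissible houses, \<open>d\<close> is the labelling,
  and \<open>g\<close> is the supposed matching.\<close>

lemma no_matching_if_labels_large:
  fixes F :: "'a \<Rightarrow> 'h set" and d :: "'h \<Rightarrow> nat"
  assumes fin: "finite M" "finite H"
    and owner: "\<And>h. h \<in> H \<Longrightarrow> 0 < d h \<Longrightarrow> owner h \<in> M"
    and inj: "inj_on owner {h\<in>H. 0 < d h}"
    and near: "\<And>h h'. h \<in> H \<Longrightarrow> 0 < d h \<Longrightarrow> h' \<in> F (owner h) \<Longrightarrow> d h \<le> Suc (d h')"
    and i: "i \<in> M" "\<And>h. h \<in> H \<Longrightarrow> 0 < d h \<Longrightarrow> owner h \<noteq> i"
      "\<And>h. h \<in> F i \<Longrightarrow> card M \<le> d h"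
    and g: "inj_on g M" "\<And>j. j \<in> M \<Longrightarrow> g j \<in> F j" "\<And>j. j \<in> M \<Longrightarrow> g j \<in> H"
  shows False
proof -
  define D where "D k = {h\<in>H. k \<le> d h}" for k
  \<comment> \<open>Under \<open>g\<close>, the agents in \<open>Z k\<close> have to fit into the
    houses \<open>D k\<close>. The agent \<open>i\<close> owns nothing, which accounts for the extra
    element of \<open>Z k\<close>.\<close>
  define Z where "Z k = insert i (owner ` D (Suc k))" for k
  have finD: "finite (D k)" for k using fin by (simp add: D_def)
  have cardZ: "card (Z k) = Suc (card (D (Suc k)))" for k
  proof -
    have "owner h \<noteq> i" if "h \<in> D (Suc k)" for h
      using i(2)[of h] that by (simp add: D_def)
    then have "i \<notin> owner ` D (Suc k)" by blast
    moreover have "inj_on owner (D (Suc k))"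
      by (rule inj_on_subset[OF inj]) (auto simp: D_def)
    ultimately show ?thesis using finD by (simp add: Z_def card_image)
  qed
  have ZM: "Z k \<subseteq> M" for k using owner i(1) by (auto simp: Z_def D_def)
  have step: "Suc (card (D (Suc k))) \<le> card (D k)" if "k \<le> card M" for k
  proof -
    \<comment> \<open>For \<open>j = i\<close> this comes from the large labels of its admissible
      houses, for an owner from \<open>near\<close>, which allows a drop of at most one.\<close>
    have "k \<le> d (g j)" if j: "j \<in> Z k" for j
    proof (cases "j = i")
      case True
      then show ?thesis using i(3)[OF g(2)[OF i(1)]] \<open>k \<le> card M\<close> by simp
    next
      case False
      then obtain h where h: "h \<in> H" "Suc k \<le> d h" "j = owner h"
        using j by (auto simp: Z_def D_def)
      then have "d h \<le> Suc (d (g j))" using near[of h "g j"] g(2) j ZM by auto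
      then show ?thesis using h by simp
    qed
    then have "g ` Z k \<subseteq> D k" using g(3) ZM by (auto simp: D_def)
    then have "card (g ` Z k) \<le> card (D k)" using finD card_mono by blast
    then show ?thesis
      using card_image[OF inj_on_subset[OF g(1) ZM]] cardZ by simp
  qed
  \<comment> \<open>Downward induction from \<open>k = card M\<close>, where the left side is 0. At
    \<open>k = 0\<close> it yields \<open>card M\<close> owned houses, hence with \<open>i\<close>
    more agents than \<open>M\<close> has.\<close>
  have "card M - k \<le> card (D (Suc k))" if "k \<le> card M" for k
    using that
  proof (induction rule: inc_induct)
    case (step k)
    then show ?case using \<open>\<And>k. k \<le> card M \<Longrightarrow> Suc (card (D (Suc k))) \<le> card (D k)\<close>[of "Suc k"]
      by linarith
  qed simp
  from this[of 0] have "Suc (card M) \<le> card (Z 0)" using cardZ by simp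
  moreover have "card (Z 0) \<le> card M" using ZM fin card_mono by blast
  ultimately show False by simp
qed

section \<open>Time-bounded total correctness\<close>

text \<open>One bounded execution suffices, since by \<open>exec_deterministic\<close> there is no
  other.\<close>

definition runs :: "com \<Rightarrow> state \<Rightarrow> nat \<Rightarrow> (state \<Rightarrow> bool) \<Rightarrow> bool" where
  "runs c s T Q \<longleftrightarrow> (\<exists>t s'. exec c s t s' \<and> t \<le> T \<and> Q s')"

lemma runs_mono:
  "runs c s T Q \<Longrightarrow> T \<le> T' \<Longrightarrow> (\<And>s'. Q s' \<Longrightarrow> Q' s') \<Longrightarrow> runs c s T' Q'"
  unfolding runs_def by (meson order_trans)

lemma runs_Seq:
  assumes "runs c s T P" "\<And>s'. P s' \<Longrightarrow> runs d s' T' Q"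
  shows "runs (Seq c d) s (1 + T + T') Q"
  using assms unfolding runs_def by (metis exec.Seq add_le_mono order_refl)

lemma runs_Cond:
  assumes "bval b s \<Longrightarrow> runs c s T Q" "\<not> bval b s \<Longrightarrow> runs d s T Q"
  shows "runs (Cond b c d) s (1 + bcost b + T) Q"
  using assms unfolding runs_def
  by (cases "bval b s") (meson exec.CondTrue exec.CondFalse add_left_mono)+

text \<open>The measure \<open>f\<close> bounds the number of iterations, and \<open>Suc\<close>
  pays for the final test that fails.\<close>

lemma runs_While:
  fixes f :: "state \<Rightarrow> nat"
  assumes body: "\<And>s. I s \<Longrightarrow> bval b s \<Longrightarrow> runs c s T (\<lambda>s'. I s' \<and> f s' < f s)" and "I s"
  shows "runs (While b c) s (Suc (f s) * (1 + bcost b + T)) (\<lambda>s'. I s' \<and> \<not> bval b s')"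
  using \<open>I s\<close>
proof (induction "f s" arbitrary: s rule: less_induct)
  case less
  show ?case
  proof (cases "bval b s")
    case False
    then have "exec (While b c) s (1 + bcost b) s" by (rule exec.WhileFalse)
    then show ?thesis using False less.prems unfolding runs_def by fastforce
  next
    case True
    obtain t s' where s': "exec c s t s'" "t \<le> T" "I s'" "f s' < f s"
      using body[OF less.prems True] by (auto simp: runs_def)
    obtain t' s'' where s'': "exec (While b c) s' t' s''"
        "t' \<le> Suc (f s') * (1 + bcost b + T)" "I s''" "\<not> bval b s''"
      using less.hyps[OF s'(4,3)] by (auto simp: runs_def)
    have "Suc (f s') * (1 + bcost b + T) \<le> f s * (1 + bcost b + T)"
      using s'(4) by (intro mult_le_mono1) simp
    then have "1 + bcost b + t + t' \<le> Suc (f s) * (1 + bcost b + T)"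
      using s'(2) s''(2) by simp
    then show ?thesis
      using exec.WhileTrue[OF True s'(1) s''(1)] s''(3,4) unfolding runs_def by blast
  qed
qed

primrec loop_free :: "com \<Rightarrow> bool" where
  "loop_free SKIP \<longleftrightarrow> True"
| "loop_free (NWrite x a b) \<longleftrightarrow> True"
| "loop_free (RWrite x a b) \<longleftrightarrow> True"
| "loop_free (Seq c d) \<longleftrightarrow> loop_free c \<and> loop_free d"
| "loop_free (Cond b c d) \<longleftrightarrow> loop_free c \<and> loop_free d"
| "loop_free (While b c) \<longleftrightarrow> False"

text \<open>Both branches of a conditional are charged, so the bound is a plain sum that does not
  depend on the state.\<close>

primrec cost_bound :: "com \<Rightarrow> nat" where
  "cost_bound SKIP = 1"
| "cost_bound (NWrite x a b) = 1 + ncost a + ncost b"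
| "cost_bound (RWrite x a b) = 1 + ncost a + rcost b"
| "cost_bound (Seq c d) = 1 + cost_bound c + cost_bound d"
| "cost_bound (Cond b c d) = 1 + bcost b + cost_bound c + cost_bound d"
| "cost_bound (While b c) = 0"

primrec result :: "com \<Rightarrow> state \<Rightarrow> state" where
  "result SKIP s = s"
| "result (NWrite x a b) s = nwrite x (nval a s) (nval b s) s"
| "result (RWrite x a b) s = rwrite x (nval a s) (rval b s) s"
| "result (Seq c d) s = result d (result c s)"
| "result (Cond b c d) s = (if bval b s then result c s else result d s)"
| "result (While b c) s = s"

text \<open>Reduces code without loops to a claim about the computed state
  \<open>result c s\<close>, which the simplifier can evaluate.\<close>

lemma runs_loop_free:
  "loop_free c \<Longrightarrow> Q (result c s) \<Longrightarrow> runs c s (cost_bound c) Q"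
proof (induction c arbitrary: s Q)
  case (Seq c d)
  have "runs c s (cost_bound c) (\<lambda>s'. s' = result c s)" using Seq by simp
  from runs_Seq[OF this, of d "cost_bound d" Q] show ?case using Seq by simp
next
  case (Cond b c d)
  have "runs c s (cost_bound c + cost_bound d) Q" if "bval b s"
    by (rule runs_mono[OF Cond.IH(1)[of Q]]) (use Cond.prems that in auto)
  moreover have "runs d s (cost_bound c + cost_bound d) Q" if "\<not> bval b s"
    by (rule runs_mono[OF Cond.IH(2)[of Q]]) (use Cond.prems that in auto)
  ultimately have "runs (Cond b c d) s (1 + bcost b + (cost_bound c + cost_bound d)) Q"
    by (rule runs_Cond)
  then show ?case by (simp add: add.assoc)
next
  case SKIP
  then show ?case using exec.Skip[of s] unfolding runs_def by auto
next
  case (NWrite x a b)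
  then show ?case using exec.NWrite[of x a b s] unfolding runs_def by auto
next
  case (RWrite x a b)
  then show ?case using exec.RWrite[of x a b s] unfolding runs_def by auto
qed simp

lemma mem_write [simp]:
  "nmem (nwrite x k a s) = (nmem s)(x := (nmem s x)(k := a))"
  "rmem (nwrite x k a s) = rmem s"
  "nmem (rwrite x k r s) = nmem s"
  "rmem (rwrite x k r s) = (rmem s)(x := (rmem s x)(k := r))"
  by (simp_all add: nwrite_def rwrite_def)


section \<open>The algorithm\<close>

text \<open>
  Houses are numbered from \<open>1\<close> here, and \<open>0\<close> stands for no house (or no owner), so that the
  default content of the memory is meaningful.
\<close>

definition favourite :: "nat \<Rightarrow> (nat \<Rightarrow> nat \<Rightarrow> real) \<Rightarrow> nat \<Rightarrow> nat \<Rightarrow> bool" where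
  "favourite m v j x \<longleftrightarrow>
     1 \<le> x \<and> x \<le> m \<and> 0 < v j (x - 1) \<and> (\<forall>h<m. v j h \<le> v j (x - 1))"

text \<open>For a house instance these are the envy-free allocations of maximum welfare, by
  \<open>envy_free_max_USW_iff\<close>.\<close>

definition top_allocation :: "nat \<Rightarrow> nat \<Rightarrow> (nat \<Rightarrow> nat \<Rightarrow> real) \<Rightarrow> (nat \<rightharpoonup> nat) \<Rightarrow> bool" where
  "top_allocation n m v A \<longleftrightarrow>
     allocation {..<n} {..<m} A \<and> (\<forall>i<n. \<forall>h<m. v i h \<le> bundle_value (v i) (A i))"

text \<open>
  An outbid agent keeps its stale entry in \<open>al\<close>; agent \<open>j\<close> holds a house iff
  \<open>ow (al j) = Suc j\<close>.
\<close>

definition auction_inv ::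
    "nat \<Rightarrow> nat \<Rightarrow> (nat \<Rightarrow> nat \<Rightarrow> real) \<Rightarrow> (nat \<Rightarrow> nat) \<Rightarrow> (nat \<Rightarrow> nat) \<Rightarrow> (nat \<Rightarrow> nat) \<Rightarrow> nat \<Rightarrow> bool"
  where
  "auction_inv n m v al ow d i \<longleftrightarrow>
     ow 0 = 0 \<and> d 0 = 0 \<and> (\<forall>x. d x \<le> n) \<and>
     (\<forall>x\<in>{1..m}. d x = 0 \<longleftrightarrow> ow x = 0) \<and>
     (\<forall>x\<in>{1..m}. \<forall>j. ow x = Suc j \<longrightarrow>
        j < n \<and> al j = x \<and> (\<forall>y. favourite m v j y \<longrightarrow> d x \<le> Suc (d y))) \<and>
     (\<forall>j<n. al j \<noteq> 0 \<longrightarrow> favourite m v j (al j)) \<and>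
     (\<forall>j<i. ow (al j) = Suc j \<or> (\<forall>h<m. v j h \<le> 0))"

text \<open>The label of \<open>x\<close> was least among the favourites of \<open>i\<close>, so
  raising it by one respects the label condition for the new owner; for other owners, larger labels
  only help. The index returns to 0 because the displaced owner may precede
  \<open>i\<close>.\<close>

lemma auction_inv_bid:
  assumes inv: "auction_inv n m v al ow d i" and "i < n" "ow (al i) \<noteq> Suc i"
    and x: "favourite m v i x" "\<And>y. favourite m v i y \<Longrightarrow> d x \<le> d y" "d x < n"
  shows "auction_inv n m v (al(i := x)) (ow(x := Suc i)) (d(x := Suc (d x))) 0"
proof -
  have x1: "1 \<le> x" "x \<le> m" using x(1) by (auto simp: favourite_def)
  let ?al = "al(i := x)" and ?ow = "ow(x := Suc i)" and ?d = "d(x := Suc (d x))"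
  have "j < n \<and> ?al j = z \<and> (\<forall>y. favourite m v j y \<longrightarrow> ?d z \<le> Suc (?d y))"
    if z: "z \<in> {1..m}" "?ow z = Suc j" for z j
  proof (cases "z = x")
    case True
    then show ?thesis using z x(2) \<open>i < n\<close> by force
  next
    case False
    then have *: "j < n" "al j = z" "\<And>y. favourite m v j y \<Longrightarrow> d z \<le> Suc (d y)"
      using z inv by (auto simp: auction_inv_def)
    \<comment> \<open>If \<open>j = i\<close>, then \<open>al i\<close> would be the house
      \<open>z\<close> owned by \<open>i\<close>, but \<open>i\<close> holds no house.\<close>
    moreover have "j \<noteq> i" using * z False assms(3) by auto
    ultimately show ?thesis using False by (auto intro: le_SucI)
  qed
  moreover have "?ow 0 = 0 \<and> ?d 0 = 0" "\<forall>z. ?d z \<le> n"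
    "\<forall>z\<in>{1..m}. ?d z = 0 \<longleftrightarrow> ?ow z = 0"
    "\<forall>j<n. ?al j \<noteq> 0 \<longrightarrow> favourite m v j (?al j)"
    using inv x1 x(1,3) by (auto simp: auction_inv_def)
  ultimately show ?thesis unfolding auction_inv_def by blast
qed

lemma auction_inv_next:
  assumes "auction_inv n m v al ow d i" "ow (al i) = Suc i \<or> (\<forall>h<m. v i h \<le> 0)"
  shows "auction_inv n m v al ow d (Suc i)"
  using assms unfolding auction_inv_def by (auto simp: less_Suc_eq)

text \<open>Agents with a positive value must receive a favourite in any top allocation, so such an
  allocation would be the matching that \<open>no_matching_if_labels_large\<close> excludes. The
  threshold \<open>n\<close> suffices as at most \<open>n\<close> agents need a match.\<close>

lemma auction_inv_stuck:
  assumes inv: "auction_inv n m v al ow d i" and "i < n" "ow (al i) \<noteq> Suc i"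
    and x: "favourite m v i x" "\<And>y. favourite m v i y \<Longrightarrow> d x \<le> d y" "n \<le> d x"
  shows "\<not> top_allocation n m v A"
proof
  assume A: "top_allocation n m v A"
  let ?M = "{j. j < n \<and> (\<exists>y. favourite m v j y)}"
  define g where "g j = Suc (the (A j))" for j
  have Some: "\<exists>h. A j = Some h \<and> h < m \<and> favourite m v j (Suc h)" if j: "j \<in> ?M" for j
  proof -
    obtain y where y: "y - 1 < m" "0 < v j (y - 1)" using j by (force simp: favourite_def)
    have best: "\<forall>h<m. v j h \<le> bundle_value (v j) (A j)"
      using A j by (auto simp: top_allocation_def)
    then have pos: "0 < bundle_value (v j) (A j)" using y by force
    then obtain h where h: "A j = Some h" by (cases "A j") auto
    then have "h < m" using A by (auto simp: top_allocation_def allocation_def ran_def)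
    then show ?thesis using h best pos by (auto simp: favourite_def)
  qed
  have owned: "\<exists>j. ow z = Suc j \<and> j \<in> ?M \<and> al j = z \<and>
      (\<forall>y. favourite m v j y \<longrightarrow> d z \<le> Suc (d y))" if z: "z \<in> {1..m}" "0 < d z" for z
  proof -
    have "d z = 0 \<longleftrightarrow> ow z = 0" using inv z(1) unfolding auction_inv_def by blast
    then obtain j where j: "ow z = Suc j" using z(2) by (cases "ow z") auto
    then have *: "j < n" "al j = z" "\<forall>y. favourite m v j y \<longrightarrow> d z \<le> Suc (d y)"
      using inv z(1) unfolding auction_inv_def by blast+
    moreover have "al j \<noteq> 0 \<longrightarrow> favourite m v j (al j)"
      using inv \<open>j < n\<close> unfolding auction_inv_def by blast
    ultimately have "favourite m v j z" using z(1) by simp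
    then show ?thesis using j * by blast
  qed
  have cardM: "card ?M \<le> n" using card_mono[of "{..<n}" ?M] by auto
  show False
  proof (rule no_matching_if_labels_large[where M = ?M and H = "{1..m}" and d = d and i = i
        and owner = "\<lambda>z. ow z - 1" and g = g and F = "\<lambda>j. {y. favourite m v j y}"])
    \<comment> \<open>\<open>al\<close> recovers an owned house from its owner, so no agent owns two
      houses.\<close>
    show "inj_on (\<lambda>z. ow z - 1) {z \<in> {1..m}. 0 < d z}"
    proof (rule inj_onI)
      fix y z assume *: "y \<in> {z \<in> {1..m}. 0 < d z}" "z \<in> {z \<in> {1..m}. 0 < d z}" "ow y - 1 = ow z - 1"
      then show "y = z" using owned[of y] owned[of z] by auto
    qed
    show "ow z - 1 \<in> ?M" "ow z - 1 \<noteq> i" if "z \<in> {1..m}" "0 < d z" for z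
      using owned[OF that] assms(3) by auto
    show "i \<in> ?M" using x(1) \<open>i < n\<close> by blast
    show "inj_on g ?M"
    proof (rule inj_onI)
      fix j k assume *: "j \<in> ?M" "k \<in> ?M" "g j = g k"
      then have "A j = A k" "j \<in> dom A" "k \<in> dom A"
        using Some[OF *(1)] Some[OF *(2)] by (auto simp: g_def)
      then show "j = k" using A by (auto simp: top_allocation_def allocation_def inj_on_def)
    qed
  next
    fix z y assume "z \<in> {1..m}" "0 < d z" "y \<in> {y. favourite m v (ow z - 1) y}"
    then show "d z \<le> Suc (d y)" using owned[of z] by auto
  next
    fix y assume "y \<in> {y. favourite m v i y}"
    then show "card ?M \<le> d y" using cardM x(2)[of y] x(3) by simp
  next
    fix j assume j: "j \<in> ?M"
    show "g j \<in> {y. favourite m v j y}" "g j \<in> {1..m}" using Some[OF j] by (auto simp: g_def)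
  qed simp_all
qed

text \<open>No stale entry of \<open>al\<close> is left: a nonzero entry is a favourite of positive
  value, so the agent can only be settled by owning it. Hence \<open>al\<close> is injective on its
  nonzero entries.\<close>

lemma auction_inv_final:
  assumes inv: "auction_inv n m v al ow d n"
  shows "top_allocation n m v
    (\<lambda>i. if i < n then (case al i of 0 \<Rightarrow> None | Suc h \<Rightarrow> Some h) else None)" 
    (is "top_allocation n m v ?A")
proof -
  have al: "j < n \<and> al j = Suc h" if "?A j = Some h" for j h
    using that by (auto split: if_splits nat.splits)
  have fav: "favourite m v j (al j)" if "j < n" "al j \<noteq> 0" for j
    using inv that unfolding auction_inv_def by blast
  have held: "ow (al j) = Suc j \<or> (\<forall>h<m. v j h \<le> 0)" if "j < n" for j
    using inv that unfolding auction_inv_def by blast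
  have ow: "ow (al j) = Suc j" if "j < n" "al j \<noteq> 0" for j
  proof -
    have "al j - 1 < m" "0 < v j (al j - 1)" using fav[OF that] by (auto simp: favourite_def)
    then show ?thesis using held[OF that(1)] by (meson not_le)
  qed
  have hm: "h < m" if "?A j = Some h" for j h
    using al[OF that] fav[of j] by (auto simp: favourite_def)
  have "ran ?A \<subseteq> {..<m}"
  proof
    fix h assume "h \<in> ran ?A"
    then obtain j where "?A j = Some h" unfolding ran_def by blast
    then show "h \<in> {..<m}" using hm by blast
  qed
  moreover have "dom ?A \<subseteq> {..<n}" by (auto split: if_splits)
  moreover have "inj_on ?A (dom ?A)"
  proof (rule inj_onI)
    fix j k assume jk: "j \<in> dom ?A" "?A j = ?A k"
    obtain h where h: "?A j = Some h" using domD[OF jk(1)] by blast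
    then have "?A k = Some h" using jk(2) by metis
    then show "j = k" using al[OF h] al[of k h] ow[of j] ow[of k] by simp
  qed
  ultimately have "allocation {..<n} {..<m} ?A" unfolding allocation_def by blast
  moreover have "v j h \<le> bundle_value (v j) (?A j)" if "j < n" "h < m" for j h
  proof (cases "al j")
    case 0
    \<comment> \<open>Hence an agent with entry 0 owns nothing and is settled only because it values
      no house positively.\<close>
    have "ow 0 = 0" using inv unfolding auction_inv_def by blast
    then have "v j h \<le> 0" using held[OF that(1)] 0 that(2) by simp
    then show ?thesis using 0 that by simp
  next
    case (Suc g)
    then show ?thesis using fav[of j] that by (auto simp: favourite_def)
  qed
  ultimately show ?thesis unfolding top_allocation_def by blast
qed

section \<open>Searching a favourite house of least label\<close>

definition best_bid :: "nat \<Rightarrow> (nat \<Rightarrow> real) \<Rightarrow> (nat \<Rightarrow> nat) \<Rightarrow> nat \<Rightarrow> bool" where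
  "best_bid k u d x \<longleftrightarrow> x \<le> k \<and>
     (if x = 0 then \<forall>h<k. u h \<le> 0
      else 0 < u (x - 1) \<and>
        (\<forall>h<k. u h \<le> u (x - 1) \<and> (u h = u (x - 1) \<longrightarrow> d x \<le> d (Suc h))))"

text \<open>The order is by value, then by smaller label. Without a candidate \<open>r\<close> is 0,
  so a positive value wins, while a tie at value 0 loses because no label is below
  \<open>d 0 = 0\<close>.\<close>

lemma best_bid_Suc:
  assumes "best_bid k u d x" "d 0 = 0" "r = (if x = 0 then 0 else u (x - 1))"
  shows "best_bid (Suc k) u d
    (if r < u k \<or> r \<le> u k \<and> d (Suc k) < d x then Suc k else x)"
proof (cases "x = 0")
  case True
  then have "\<forall>h<k. u h \<le> 0" "r = 0" using assms by (simp_all add: best_bid_def)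
  then show ?thesis using True assms(2) by (force simp: best_bid_def less_Suc_eq)
next
  case False
  then have x: "x \<le> k" "0 < r" and r: "r = u (x - 1)"
    using assms by (simp_all add: best_bid_def)
  have best: "u h \<le> r" "u h = r \<Longrightarrow> d x \<le> d (Suc h)" if "h < k" for h
    using assms(1) that r False by (simp_all add: best_bid_def)
  let ?better = "r < u k \<or> r \<le> u k \<and> d (Suc k) < d x"
  show ?thesis
  proof (cases ?better)
    case True
    have "u h \<le> u k \<and> (u h = u k \<longrightarrow> d (Suc k) \<le> d (Suc h))" if "h < Suc k" for h
      using best[of h] True that by (cases "h = k") force+
    moreover have "0 < u k" using True x(2) by auto
    ultimately show ?thesis unfolding if_P[OF True] by (simp add: best_bid_def)
  next
    case worse: False
    have "u h \<le> r \<and> (u h = r \<longrightarrow> d x \<le> d (Suc h))" if "h < Suc k" for h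
      using best[of h] worse that by (cases "h = k") force+
    then show ?thesis unfolding if_not_P[OF worse] using False x r by (simp add: best_bid_def)
  qed
qed

text \<open>
  For lack of multiplication, the variable \<open>b\<close> carries the offset \<open>i * m\<close> of the row of agent \<open>i\<close>.
  In \<open>better_bid\<close>, no guard for \<open>bh = 0\<close> is needed as \<open>d[0] = 0\<close> makes the label comparison fail.
\<close>

definition var :: "vname \<Rightarrow> nexp" where
  "var x = NRead x (NConst 0)"

definition set_var :: "vname \<Rightarrow> nexp \<Rightarrow> com" where
  "set_var x a = NWrite x (NConst 0) a"

definition scan_value :: rexp where
  "scan_value = RRead ''v'' (NAdd (var ''b'') (var ''k''))"

definition scan_init :: com where
  "scan_init = Seq (set_var ''bh'' (NConst 0))
     (Seq (RWrite ''bv'' (NConst 0) RZero) (set_var ''k'' (NConst 0)))"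

definition better_bid :: bexp where
  "better_bid =
     BNot (BAnd (BNot (RLess (RRead ''bv'' (NConst 0)) scan_value))
       (BNot (BAnd (BNot (RLess scan_value (RRead ''bv'' (NConst 0))))
          (NLess (NRead ''d'' (NAdd (var ''k'') (NConst 1))) (NRead ''d'' (var ''bh''))))))"

definition scan_step :: com where
  "scan_step =
     Seq (Cond better_bid
            (Seq (set_var ''bh'' (NAdd (var ''k'') (NConst 1)))
                 (RWrite ''bv'' (NConst 0) scan_value))
            SKIP)
         (set_var ''k'' (NAdd (var ''k'') (NConst 1)))"

definition scan :: com where
  "scan = Seq scan_init (While (NLess (var ''k'') (var ''m'')) scan_step)"

definition next_agent :: com where
  "next_agent = Seq (set_var ''i'' (NAdd (var ''i'') (NConst 1)))
     (set_var ''b'' (NAdd (var ''b'') (var ''m'')))"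

text \<open>Overwriting \<open>owner\<close> displaces the former owner without visiting it; the
  restart at agent 0 will meet it again.\<close>

definition place_bid :: com where
  "place_bid = Seq (NWrite ''d'' (var ''bh'') (NAdd (NRead ''d'' (var ''bh'')) (NConst 1)))
     (Seq (NWrite ''alloc'' (var ''i'') (var ''bh''))
     (Seq (NWrite ''owner'' (var ''bh'') (NAdd (var ''i'') (NConst 1)))
     (Seq (set_var ''i'' (NConst 0)) (set_var ''b'' (NConst 0)))))"

definition give_up :: com where
  "give_up = Seq (set_var ''found'' (NConst 0)) (set_var ''i'' (var ''n''))"

definition decide :: com where
  "decide = Cond (NLess (NConst 0) (var ''bh''))
     (Cond (NLess (NRead ''d'' (var ''bh'')) (var ''n'')) place_bid give_up)
     next_agent"

text \<open>Equality is expressed by excluding both strict inequalities. An agent with entry 0 fails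
  the test since \<open>owner[0]\<close> stays 0.\<close>

definition holds_house :: bexp where
  "holds_house =
     (let x = NRead ''owner'' (NRead ''alloc'' (var ''i'')); y = NAdd (var ''i'') (NConst 1)
      in BAnd (BNot (NLess x y)) (BNot (NLess y x)))"

definition auction :: com where
  "auction = Seq (set_var ''found'' (NConst 1))
     (While (NLess (var ''i'') (var ''n''))
        (Cond holds_house next_agent (Seq scan decide)))"

lemmas program_defs = var_def set_var_def scan_value_def scan_init_def better_bid_def scan_step_def
  next_agent_def place_bid_def give_up_def decide_def holds_house_def Let_def

section \<open>Correctness and running time of the program\<close>

definition frame :: "vname set \<Rightarrow> state \<Rightarrow> state \<Rightarrow> bool" where
  "frame X s s' \<longleftrightarrow> (\<forall>x. x \<notin> X \<longrightarrow> nmem s' x = nmem s x) \<and> rmem s' ''v'' = rmem s ''v''"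

lemma runs_scan:
  assumes m: "nmem s ''m'' 0 = m" and d: "nmem s ''d'' 0 = 0"
  defines "u \<equiv> \<lambda>h. rmem s ''v'' (nmem s ''b'' 0 + h)"
  shows "runs scan s (100 * Suc m)
    (\<lambda>s'. frame {''bh'', ''k''} s s' \<and> best_bid m u (nmem s ''d'') (nmem s' ''bh'' 0))"
proof -
  \<comment> \<open>\<open>bh\<close> is the best bid among the first \<open>k\<close> houses, and
    the scratch cell \<open>bv\<close> caches its value, with 0 for no candidate.\<close>
  define I where "I s' \<longleftrightarrow> frame {''bh'', ''k''} s s' \<and> nmem s' ''k'' 0 \<le> m \<and>
      best_bid (nmem s' ''k'' 0) u (nmem s ''d'') (nmem s' ''bh'' 0) \<and>
      rmem s' ''bv'' 0 = (if nmem s' ''bh'' 0 = 0 then 0 else u (nmem s' ''bh'' 0 - 1))" for s'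
  have init: "runs scan_init s (cost_bound scan_init) (\<lambda>s'. I s' \<and> nmem s' ''k'' 0 = 0)"
    by (rule runs_loop_free) (simp_all add: program_defs I_def frame_def best_bid_def)
  have step: "runs scan_step s' (cost_bound scan_step)
      (\<lambda>s''. I s'' \<and> m - nmem s'' ''k'' 0 < m - nmem s' ''k'' 0)"
    if I: "I s'" and b: "bval (NLess (var ''k'') (var ''m'')) s'" for s'
  proof (rule runs_loop_free)
    have k: "nmem s' ''k'' 0 < m" using I b m by (simp add: I_def frame_def program_defs)
    have best: "best_bid (Suc (nmem s' ''k'' 0)) u (nmem s ''d'')
       (if rmem s' ''bv'' 0 < u (nmem s' ''k'' 0) \<or> rmem s' ''bv'' 0 \<le> u (nmem s' ''k'' 0) \<and>
          nmem s ''d'' (Suc (nmem s' ''k'' 0)) < nmem s ''d'' (nmem s' ''bh'' 0)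
        then Suc (nmem s' ''k'' 0) else nmem s' ''bh'' 0)"
      using I d by (intro best_bid_Suc) (auto simp: I_def)
    have same: "nmem s' ''b'' = nmem s ''b''" "nmem s' ''d'' = nmem s ''d''"
      "rmem s' ''v'' = rmem s ''v''" using I by (auto simp: I_def frame_def)
    have better: "bval better_bid s' \<longleftrightarrow>
        rmem s' ''bv'' 0 < u (nmem s' ''k'' 0) \<or> rmem s' ''bv'' 0 \<le> u (nmem s' ''k'' 0) \<and>
          nmem s ''d'' (Suc (nmem s' ''k'' 0)) < nmem s ''d'' (nmem s' ''bh'' 0)"
      by (auto simp: better_bid_def scan_value_def var_def same u_def not_less)
    have val: "rval scan_value (nwrite ''bh'' 0 x s') = u (nmem s' ''k'' 0)" for x
      by (simp add: scan_value_def var_def same u_def)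
    have dec: "m - Suc (nmem s' ''k'' 0) < m - nmem s' ''k'' 0" using k by linarith
    show "I (result scan_step s') \<and> m - nmem (result scan_step s') ''k'' 0 < m - nmem s' ''k'' 0"
    proof (cases "bval better_bid s'")
      case True
      then show ?thesis
        using I k best[folded better] val dec
        by (simp add: scan_step_def set_var_def var_def I_def frame_def)
    next
      case False
      then show ?thesis
        using I k best[folded better] dec
        by (simp add: scan_step_def set_var_def var_def I_def frame_def)
    qed
  qed (simp add: program_defs)
  have loop: "runs (While (NLess (var ''k'') (var ''m'')) scan_step) s'
      (Suc m * (1 + bcost (NLess (var ''k'') (var ''m'')) + cost_bound scan_step))
      (\<lambda>s'. frame {''bh'', ''k''} s s' \<and> best_bid m u (nmem s ''d'') (nmem s' ''bh'' 0))"
    if s': "I s' \<and> nmem s' ''k'' 0 = 0" for s'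
  proof -
    let ?b = "NLess (var ''k'') (var ''m'')"
    have "runs (While ?b scan_step) s'
        (Suc (m - nmem s' ''k'' 0) * (1 + bcost ?b + cost_bound scan_step))
        (\<lambda>s''. I s'' \<and> \<not> bval ?b s'')"
      using s' by (intro runs_While step) simp_all
    then show ?thesis
    proof (rule runs_mono)
      fix s'' assume s'': "I s'' \<and> \<not> bval ?b s''"
      then have "nmem s'' ''m'' = nmem s ''m''" by (simp add: I_def frame_def)
      then have "nmem s'' ''k'' 0 = m" using s'' m by (simp add: I_def var_def)
      then show "frame {''bh'', ''k''} s s'' \<and> best_bid m u (nmem s ''d'') (nmem s'' ''bh'' 0)"
        using s'' by (simp add: I_def)
    qed (use s' in simp)
  qed
  show ?thesis
    unfolding scan_def using runs_Seq[OF init loop]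
    by (rule runs_mono) (simp_all add: program_defs)
qed

definition outer_inv :: "nat \<Rightarrow> nat \<Rightarrow> (nat \<Rightarrow> nat \<Rightarrow> real) \<Rightarrow> state \<Rightarrow> bool" where
  "outer_inv n m v s \<longleftrightarrow>
     nmem s ''n'' 0 = n \<and> nmem s ''m'' 0 = m \<and> nmem s ''i'' 0 \<le> n \<and>
     rmem s ''v'' = rmem (input n m v) ''v'' \<and>
     (if nmem s ''found'' 0 = 0
      then nmem s ''i'' 0 = n \<and> (\<forall>A. \<not> top_allocation n m v A)
      else nmem s ''b'' 0 = nmem s ''i'' 0 * m \<and>
        auction_inv n m v (nmem s ''alloc'') (nmem s ''owner'') (nmem s ''d'') (nmem s ''i'' 0))"

text \<open>
  Each bid raises a label, and no label exceeds \<open>n\<close>; this pays for restarting at agent \<open>0\<close>.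
\<close>

definition potential :: "nat \<Rightarrow> nat \<Rightarrow> (nat \<Rightarrow> nat) \<Rightarrow> nat \<Rightarrow> nat" where
  "potential n m d i = (m * n - (\<Sum>x=1..m. d x)) * Suc n + (n - i)"

definition remaining :: "nat \<Rightarrow> nat \<Rightarrow> state \<Rightarrow> nat" where
  "remaining n m s = potential n m (nmem s ''d'') (nmem s ''i'' 0)"

text \<open>The bid costs one factor \<open>Suc n\<close>, while resetting the index gains at most
  \<open>n\<close>. The label sum stays at most \<open>m * n\<close>, so the truncated subtraction
  really drops by one.\<close>

lemma bid_decreases:
  fixes d :: "nat \<Rightarrow> nat"
  assumes "\<And>x. d x \<le> n" "x \<in> {1..m}" "d x < n" "i < n"
  shows "potential n m (d(x := Suc (d x))) 0 < potential n m d i"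
proof -
  have eq: "(\<Sum>y=1..m. (d(x := Suc (d x))) y) = Suc (\<Sum>y=1..m. d y)"
  proof -
    have "d(x := Suc (d x)) = (\<lambda>y. d y + (if y = x then 1 else 0))" by auto
    then show ?thesis using assms(2) by (simp only: sum.distrib sum.delta) simp
  qed
  have "(\<Sum>y=1..m. (d(x := Suc (d x))) y) \<le> (\<Sum>y=1..m. n)"
    using assms(1,3) by (intro sum_mono) (auto simp: Suc_le_eq)
  then have "(\<Sum>y=1..m. d y) < m * n" using eq by simp
  then obtain k where k: "m * n - (\<Sum>y=1..m. d y) = Suc k" by (metis Suc_diff_Suc)
  then have "m * n - Suc (\<Sum>y=1..m. d y) = k" by linarith
  then show ?thesis unfolding potential_def eq k using assms(4) by simp
qed

lemma runs_decide:
  assumes inv: "outer_inv n m v s" and i: "nmem s ''i'' 0 < n"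
    and free: "\<not> bval holds_house s" and fr: "frame {''bh'', ''k''} s s'"
    and best: "best_bid m (\<lambda>h. rmem s ''v'' (nmem s ''b'' 0 + h)) (nmem s ''d'') (nmem s' ''bh'' 0)"
  shows "runs decide s' (cost_bound decide)
    (\<lambda>s''. outer_inv n m v s'' \<and> remaining n m s'' < remaining n m s)"
proof (rule runs_loop_free)
  let ?i = "nmem s ''i'' 0" and ?x = "nmem s' ''bh'' 0"
    and ?al = "nmem s ''alloc''" and ?ow = "nmem s ''owner''" and ?d = "nmem s ''d''"
  have same: "nmem s' ''n'' = nmem s ''n''" "nmem s' ''m'' = nmem s ''m''"
    "nmem s' ''i'' = nmem s ''i''" "nmem s' ''b'' = nmem s ''b''" "nmem s' ''d'' = ?d"
    "nmem s' ''alloc'' = ?al" "nmem s' ''owner'' = ?ow" "nmem s' ''found'' = nmem s ''found''"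
    "rmem s' ''v'' = rmem s ''v''"
    using fr by (auto simp: frame_def)
  have s: "nmem s ''n'' 0 = n" "nmem s ''m'' 0 = m" "rmem s ''v'' = rmem (input n m v) ''v''"
    "nmem s ''found'' 0 > 0" "nmem s ''b'' 0 = ?i * m" and auc: "auction_inv n m v ?al ?ow ?d ?i"
    using inv i by (cases "nmem s ''found'' 0 = 0"; simp add: outer_inv_def)+
  have un: "?ow (?al ?i) \<noteq> Suc ?i" using free by (auto simp: program_defs)
  define u where "u h = rmem s ''v'' (nmem s ''b'' 0 + h)" for h
  have best: "best_bid m u ?d ?x" using best by (simp add: u_def[abs_def])
  have val: "u h = v ?i h" if "h < m" for h
  proof -
    \<comment> \<open>The cell lies in row \<open>i\<close> and inside the input, so division and
      remainder by \<open>m\<close> recover \<open>i\<close> and \<open>h\<close>.\<close>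
    have "?i * m + h < Suc ?i * m" using that by simp
    also have "\<dots> \<le> n * m" using i by (intro mult_le_mono1) simp
    finally show ?thesis using that s by (simp add: u_def input_def)
  qed
  have no: "\<forall>h<m. v ?i h \<le> 0" if "?x = 0"
    using best that val by (simp add: best_bid_def)
  have fav: "favourite m v ?i ?x" "favourite m v ?i y \<Longrightarrow> ?d ?x \<le> ?d y" if x: "?x \<noteq> 0" for y
  proof -
    have *: "?x \<le> m" "0 < v ?i (?x - 1)"
      "\<And>h. h < m \<Longrightarrow> v ?i h \<le> v ?i (?x - 1) \<and> (v ?i h = v ?i (?x - 1) \<longrightarrow> ?d ?x \<le> ?d (Suc h))"
      using best x val[of "?x - 1"] val by (auto simp: best_bid_def)
    then show "favourite m v ?i ?x" using x by (auto simp: favourite_def)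
    assume y: "favourite m v ?i y"
    then have y': "y - 1 < m" "Suc (y - 1) = y" by (auto simp: favourite_def)
    have "?x - 1 < m" using *(1) x by simp
    \<comment> \<open>Both houses have maximal value, so they tie and the comparison of labels
      applies.\<close>
    then have "v ?i (?x - 1) \<le> v ?i (y - 1)" using y unfolding favourite_def by blast
    then have "v ?i (y - 1) = v ?i (?x - 1)" using *(3)[OF y'(1)] by simp
    with y' show "?d ?x \<le> ?d y" using *(3)[of "y - 1"] by simp
  qed
  have dn: "\<And>x. ?d x \<le> n" using auc by (auto simp: auction_inv_def)
  let ?P = "\<lambda>s''. outer_inv n m v s'' \<and> remaining n m s'' < remaining n m s"
  consider (none) "?x = 0" | (bid) "?x \<noteq> 0" "?d ?x < n" | (stuck) "?x \<noteq> 0" "n \<le> ?d ?x"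
    by linarith
  then show "?P (result decide s')"
  proof cases
    case none
    then show ?thesis
      using auction_inv_next[OF auc] no i s
      by (simp add: program_defs same outer_inv_def remaining_def potential_def)
  next
    case bid
    have x: "?x \<in> {1..m}" using fav(1) bid by (auto simp: favourite_def)
    show ?thesis
      using auction_inv_bid[OF auc i un fav] bid_decreases[of ?d, OF dn x bid(2) i] bid s
      by (simp add: program_defs same outer_inv_def remaining_def)
  next
    \<comment> \<open>\<open>give_up\<close> keeps the labels and moves the index to
      \<open>n\<close>, so the potential drops by \<open>n - i > 0\<close> and the loop
      ends.\<close>
    case stuck
    then show ?thesis
      using auction_inv_stuck[OF auc i un fav] i s
      by (simp add: program_defs same outer_inv_def remaining_def potential_def)
  qed
qed (simp add: program_defs)

text \<open>The initial potential allows cubically many iterations, each with a scan linear in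
  \<open>m\<close>; together this is quartic in \<open>n + m + 1\<close>.\<close>

lemma runs_auction:
  "runs auction (input n m v) (1000 * (n + m + 1) ^ 4)
     (\<lambda>s. outer_inv n m v s \<and> nmem s ''i'' 0 = n)"
proof -
  let ?b = "NLess (var ''i'') (var ''n'')"
  let ?body = "Cond holds_house next_agent (Seq scan decide)"
  let ?T = "300 * Suc m"
  let ?init = "set_var ''found'' (NConst 1)"
  have step: "runs ?body s ?T (\<lambda>s'. outer_inv n m v s' \<and> remaining n m s' < remaining n m s)"
    if inv: "outer_inv n m v s" and b: "bval ?b s" for s
  proof -
    have i: "nmem s ''i'' 0 < n" using inv b by (simp add: outer_inv_def program_defs)
    have found: "nmem s ''found'' 0 \<noteq> 0"
      using inv i by (cases "nmem s ''found'' 0 = 0") (simp_all add: outer_inv_def)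
    then have auc: "auction_inv n m v (nmem s ''alloc'') (nmem s ''owner'') (nmem s ''d'') (nmem s ''i'' 0)"
      using inv by (simp add: outer_inv_def)
    have "runs ?body s (1 + bcost holds_house + 200 * Suc m)
        (\<lambda>s'. outer_inv n m v s' \<and> remaining n m s' < remaining n m s)"
    proof (rule runs_Cond)
      assume "bval holds_house s"
      then have "nmem s ''owner'' (nmem s ''alloc'' (nmem s ''i'' 0)) = Suc (nmem s ''i'' 0)"
        by (simp add: program_defs)
      then have "runs next_agent s (cost_bound next_agent)
          (\<lambda>s'. outer_inv n m v s' \<and> remaining n m s' < remaining n m s)"
        using auction_inv_next[OF auc] inv i found
        by (intro runs_loop_free) (simp_all add: program_defs outer_inv_def remaining_def potential_def)
      then show "runs next_agent s (200 * Suc m)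
          (\<lambda>s'. outer_inv n m v s' \<and> remaining n m s' < remaining n m s)"
        by (rule runs_mono) (simp_all add: program_defs)
    next
      assume free: "\<not> bval holds_house s"
      have "nmem s ''m'' 0 = m" "nmem s ''d'' 0 = 0"
        using inv auc by (auto simp: outer_inv_def auction_inv_def)
      from runs_Seq[OF runs_scan[OF this] runs_decide[OF inv i free]]
      show "runs (Seq scan decide) s (200 * Suc m)
          (\<lambda>s'. outer_inv n m v s' \<and> remaining n m s' < remaining n m s)"
        by (rule runs_mono) (auto simp: program_defs)
    qed
    then show ?thesis by (rule runs_mono) (simp_all add: program_defs)
  qed
  let ?Q = "\<lambda>s. outer_inv n m v s \<and> nmem s ''i'' 0 = n"
  have loop: "runs (While ?b ?body) s (Suc (m * n * Suc n + n) * (1 + bcost ?b + ?T)) ?Q"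
    if "outer_inv n m v s \<and> remaining n m s \<le> m * n * Suc n + n" for s
  proof -
    have "Suc (remaining n m s) * (1 + bcost ?b + ?T)
        \<le> Suc (m * n * Suc n + n) * (1 + bcost ?b + ?T)"
      using that by (intro mult_le_mono1) simp
    moreover have "runs (While ?b ?body) s (Suc (remaining n m s) * (1 + bcost ?b + ?T))
        (\<lambda>s. outer_inv n m v s \<and> \<not> bval ?b s)"
      using that by (intro runs_While step) simp_all
    ultimately show ?thesis
      by (elim runs_mono) (auto simp: outer_inv_def program_defs)
  qed
  \<comment> \<open>The zero-initialised memory satisfies the invariant: all labels are 0, nobody
    owns a house, and no agent precedes index 0.\<close>
  have "runs ?init (input n m v) (cost_bound ?init)
      (\<lambda>s. outer_inv n m v s \<and> remaining n m s \<le> m * n * Suc n + n)"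
    by (intro runs_loop_free)
      (simp_all add: program_defs outer_inv_def remaining_def potential_def input_def auction_inv_def)
  from runs_Seq[OF this loop] show ?thesis
    unfolding auction_def
  proof (rule runs_mono)
    let ?N = "n + m + 1"
    have "Suc (m * n * Suc n + n) \<le> ?N ^ 3"
      by (simp add: power3_eq_cube algebra_simps)
    then have "Suc (m * n * Suc n + n) * (310 * ?N) \<le> ?N ^ 3 * (310 * ?N)"
      by (rule mult_le_mono1)
    moreover have "Suc (m * n * Suc n + n) * (1 + bcost ?b + ?T) \<le> Suc (m * n * Suc n + n) * (310 * ?N)"
      by (intro mult_le_mono2) (simp add: program_defs)
    moreover have "?N ^ 3 * (310 * ?N) = 310 * ?N ^ 4"
      by (simp only: power4_eq_xxxx power3_eq_cube mult_ac)
    moreover have "1 \<le> ?N ^ 4" by simp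
    moreover have "cost_bound ?init \<le> 10" by (simp add: program_defs)
    ultimately show "1 + cost_bound ?init + Suc (m * n * Suc n + n) * (1 + bcost ?b + ?T)
        \<le> 1000 * ?N ^ 4"
      by linarith
  qed simp
qed

theorem proposition1:
  "\<exists>(prog :: com) (p :: nat poly).
     \<forall>(n :: nat) (m :: nat) (v :: nat \<Rightarrow> nat \<Rightarrow> real).
       house_instance {..<n} {..<m} v \<longrightarrow>
       (\<exists>t s. exec prog (input n m v) t s \<and> t \<le> poly p (n + m) \<and>
          (case answer n s of
             Some A \<Rightarrow> envy_free_max_USW {..<n} {..<m} v A
           | None \<Rightarrow> \<not> (\<exists>A. envy_free_max_USW {..<n} {..<m} v A)))"
\<comment> \<open>\<open>[:1, 1:]\<close> is the polynomial \<open>1 + x\<close>, so the witness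
  evaluated at \<open>n + m\<close> is the bound of \<open>runs_auction\<close>.\<close>
proof (rule exI[of _ auction], rule exI[of _ "smult 1000 ([:1, 1:] ^ 4)"], intro allI impI)
  fix n m :: nat and v :: "nat \<Rightarrow> nat \<Rightarrow> real"
  assume "house_instance {..<n} {..<m} v"
  then have iff: "envy_free_max_USW {..<n} {..<m} v A \<longleftrightarrow> top_allocation n m v A" for A
    by (simp add: envy_free_max_USW_iff top_allocation_def Ball_def)
  obtain t s where ex: "exec auction (input n m v) t s" and t: "t \<le> 1000 * (n + m + 1) ^ 4"
    and inv: "outer_inv n m v s" "nmem s ''i'' 0 = n"
    using runs_auction[of n m v] by (auto simp: runs_def)
  have "t \<le> poly (smult 1000 ([:1, 1:] ^ 4)) (n + m)"
    using t by (simp add: poly_power add.commute)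
  moreover have "case answer n s of
      Some A \<Rightarrow> envy_free_max_USW {..<n} {..<m} v A
    | None \<Rightarrow> \<not> (\<exists>A. envy_free_max_USW {..<n} {..<m} v A)"
    \<comment> \<open>If \<open>found\<close> is 0, \<open>outer_inv\<close> refutes every top
      allocation; otherwise the index is \<open>n\<close> and the decoded \<open>alloc\<close> is
      one.\<close>
    using inv auction_inv_final[of n m v "nmem s ''alloc''"]
    by (auto simp: iff answer_def outer_inv_def split: if_splits)
  ultimately show "\<exists>t s. exec auction (input n m v) t s \<and>
      t \<le> poly (smult 1000 ([:1, 1:] ^ 4)) (n + m) \<and>
      (case answer n s of
         Some A \<Rightarrow> envy_free_max_USW {..<n} {..<m} v A
       | None \<Rightarrow> \<not> (\<exists>A. envy_free_max_USW {..<n} {..<m} v A))"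
    using ex by blast
qed

end
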